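(* Let $1\le m\le n$ and $n\to\infty$. Then $$\sqrt{\frac{n!}{m!}}\;e^{-2c_1\sqrt{n}\,(1+o(1))}\,\le\,\mathsf{F}(m,n)\,\le\,\sqrt{\frac{n!}{m!}}\;e^{2c_1\sqrt{n}\,(1+o(1))},$$ where $c_1=\pi\sqrt{1/6}$ and $o(1)\to 0$ as $n\to\infty$, for any choice of $m=m(n)$ with $1\le m\le n$.
   Context: $f^{\lambda/\mu}$ denotes the number of standard Young tableaux of skew shape $\lambda/\mu$ (zero if $\mu\not\subseteq\lambda$). For $0\le m\le n$, define $\mathsf{F}(m,n):=\max_{\lambda\vdash n}\max_{\mu\vdash m} f^{\lambda/\mu}$. *)

theory Defs
  imports Complex_Main "HOL-Library.FuncSet"
begin

definition partitions :: "nat \<Rightarrow> nat list set" where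
  "partitions n = {l. sorted_wrt (\<ge>) l \<and> (\<forall>x \<in> set l. 0 < x) \<and> sum_list l = n}"

(* English notation: the cell (i, j) lies in row i and column j, both counted from 0. *)
definition young_diagram :: "nat list \<Rightarrow> (nat \<times> nat) set" where
  "young_diagram l = {(i, j). i < length l \<and> j < l ! i}"

definition skew_diagram :: "nat list \<Rightarrow> nat list \<Rightarrow> (nat \<times> nat) set" where
  "skew_diagram l u = young_diagram l - young_diagram u"

(* Fillings are extensional, i.e. undefined outside the shape, so that two of them are equal
   iff they agree on all cells of the shape. *)
definition skew_SYT :: "nat list \<Rightarrow> nat list \<Rightarrow> (nat \<times> nat \<Rightarrow> nat) set" where
  "skew_SYT l u = {T \<in> extensional (skew_diagram l u).
     bij_betw T (skew_diagram l u) {1..card (skew_diagram l u)} \<and>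
     (\<forall>i j j'. (i, j) \<in> skew_diagram l u \<longrightarrow> (i, j') \<in> skew_diagram l u \<longrightarrow> j < j'
        \<longrightarrow> T (i, j) < T (i, j')) \<and>
     (\<forall>i i' j. (i, j) \<in> skew_diagram l u \<longrightarrow> (i', j) \<in> skew_diagram l u \<longrightarrow> i < i'
        \<longrightarrow> T (i, j) < T (i', j))}"

definition num_skew_SYT :: "nat list \<Rightarrow> nat list \<Rightarrow> nat" where
  "num_skew_SYT l u =
     (if young_diagram u \<subseteq> young_diagram l then card (skew_SYT l u) else 0)"

definition max_skew_SYT :: "nat \<Rightarrow> nat \<Rightarrow> nat" where
  "max_skew_SYT m n =
     Max ((\<lambda>l. Max ((\<lambda>u. num_skew_SYT l u) ` partitions m)) ` partitions n)"

definition c1 :: real where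
  "c1 = pi * sqrt (1 / 6)"

(* Finiteness and non-emptiness make the maxima above genuine. *)

lemma finite_partitions: "finite (partitions n)"
proof (rule finite_subset)
  show "partitions n \<subseteq> {l. set l \<subseteq> {..n} \<and> length l \<le> n}"
  proof
    fix l assume l: "l \<in> partitions n"
    have "length l \<le> sum_list l" if "\<forall>x \<in> set l. 0 < x" for l :: "nat list"
      using that by (induction l) auto
    with l show "l \<in> {l. set l \<subseteq> {..n} \<and> length l \<le> n}"
      by (auto simp: partitions_def member_le_sum_list)
  qed
  show "finite {l. set l \<subseteq> {..n} \<and> length l \<le> n}"
    by (rule finite_lists_length_le) simp
qed

lemma partitions_nonempty: "partitions n \<noteq> {}"
proof -
  have "replicate n 1 \<in> partitions n"
    by (auto simp: partitions_def sum_list_replicate sorted_wrt_iff_nth_less)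
  then show ?thesis by blast
qed

lemma finite_skew_diagram: "finite (skew_diagram l u)"
proof (rule finite_subset)
  show "skew_diagram l u \<subseteq> {..<length l} \<times> {..<Suc (sum_list l)}"
    by (auto simp: skew_diagram_def young_diagram_def less_Suc_eq_le
        intro!: order.trans[OF less_imp_le member_le_sum_list])
qed simp

lemma finite_skew_SYT: "finite (skew_SYT l u)"
proof (rule finite_subset)
  show "skew_SYT l u \<subseteq> skew_diagram l u \<rightarrow>\<^sub>E {1..card (skew_diagram l u)}"
    by (auto simp: skew_SYT_def PiE_def bij_betw_def)
  show "finite (skew_diagram l u \<rightarrow>\<^sub>E {1..card (skew_diagram l u)})"
    by (intro finite_PiE finite_skew_diagram) simp
qed

end

theory Submission
  imports Defs "HOL-Analysis.Gamma_Function"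
begin

text \<open>
  Write \<open>f (L/M)\<close> for the number of standard tableaux of shape \<open>L/M\<close> and \<open>f L\<close> for the case of empty \<open>M\<close>.
  Let \<open>U\<close> and \<open>D\<close> be the operators on functions on Young's lattice that sum over lower and over upper
  covers. They are adjoint to each other, and a diagram has one more addable than removable cell,
  which gives \<open>D U = U D + I\<close> (lemma \<open>down_up\<close>). Removing the largest entry of a tableau shows that
  \<open>f (L/M)\<close> is the coefficient at \<open>L\<close> of a power of \<open>U\<close> applied to the indicator of \<open>M\<close>
  (lemma \<open>skew_count_Suc\<close>).

  The upper bound: the commutation relation implies that \<open>U\<close> has squared norm at most \<open>k + 1\<close> on the
  diagrams of size \<open>k\<close> (lemma \<open>up_bound\<close>). Going from level \<open>m\<close> to level \<open>n\<close>, a coefficient is at most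
  \<open>sqrt (n! / m!)\<close>, even without the exponential factor.

  The lower bound: if \<open>F\<close> is the maximum, then \<open>n! = \<Sum>(f L)\<^sup>2 = \<Sum>f L * f (L/M) * f M \<le> F * (\<Sum>f L) * (\<Sum>f M)\<close>,
  where \<open>L\<close> and \<open>M\<close> range over the diagrams of sizes \<open>n\<close> and \<open>m\<close>. By Cauchy-Schwarz the two sums
  are at most \<open>sqrt (p n * n!)\<close> and \<open>sqrt (p m * m!)\<close> with \<open>p\<close> the partition function, and
  \<open>p n \<le> exp (2 * c1 * sqrt n)\<close> (lemma \<open>card_partitions_le\<close>). So the loss is at most
  \<open>exp (c1 * sqrt n + c1 * sqrt m)\<close>, where \<open>m \<le> n\<close>.
\<close>

section \<open>The number of partitions\<close>

definition partitions_upto :: "nat \<Rightarrow> nat \<Rightarrow> nat list set" where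
  "partitions_upto k n = {l \<in> partitions n. \<forall>x\<in>set l. x \<le> k}"

lemma finite_partitions_upto: "finite (partitions_upto k n)"
  unfolding partitions_upto_def using finite_partitions by simp

lemma partitions_upto_0: "partitions_upto 0 n \<subseteq> (if n = 0 then {[]} else {})"
proof
  fix l assume "l \<in> partitions_upto 0 n"
  then have "\<forall>x\<in>set l. 0 < x \<and> x \<le> 0" "sum_list l = n"
    by (simp_all add: partitions_upto_def partitions_def)
  then show "l \<in> (if n = 0 then {[]} else {})" by (cases l) auto
qed

text \<open>
  Either the part \<open>Suc k\<close> does not occur, or it is the head of the decreasing list and can be
  removed.
\<close>

lemma partitions_upto_Suc:
  "partitions_upto (Suc k) n \<subseteq> partitions_upto k n \<union>
     (if Suc k \<le> n then (#) (Suc k) ` partitions_upto (Suc k) (n - Suc k) else {})"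
proof
  fix l assume l: "l \<in> partitions_upto (Suc k) n"
  show "l \<in> partitions_upto k n \<union>
     (if Suc k \<le> n then (#) (Suc k) ` partitions_upto (Suc k) (n - Suc k) else {})"
  proof (cases "Suc k \<in> set l")
    case False
    then have "x \<le> k" if "x \<in> set l" for x
      using l that unfolding partitions_upto_def by (metis (lifting) le_Suc_eq mem_Collect_eq)
    then show ?thesis using l by (simp add: partitions_upto_def)
  next
    case True
    then obtain x u where xu: "l = x # u" by (cases l) auto
    then have "x = Suc k"
      using l True by (auto simp: partitions_upto_def partitions_def intro: le_antisym)
    then show ?thesis
      using l xu by (auto simp: partitions_upto_def partitions_def intro!: imageI)
  qed
qed

text \<open>
  The right-hand side \<open>P k\<close> is the generating function of the partitions with parts at most
  \<open>k\<close>, so each of its terms is at most the whole. The proof is by induction: the recursion for partitions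
  matches \<open>P k = P (Suc k) - x ^ Suc k * P (Suc k)\<close>.
\<close>

lemma card_partitions_upto_le:
  fixes x :: real
  assumes x: "0 < x" "x < 1"
  shows "card (partitions_upto k n) * x ^ n \<le> (\<Prod>i=1..k. 1 / (1 - x ^ i))"
proof (induction k arbitrary: n)
  case 0
  have "card (partitions_upto 0 n) \<le> card (if n = 0 then {[] :: nat list} else {})"
    by (intro card_mono partitions_upto_0) auto
  then show ?case by (cases "n = 0") auto
next
  case (Suc k)
  let ?P = "\<lambda>k. \<Prod>i=1..k. 1 / (1 - x ^ i)"
  have xk: "x ^ Suc k < 1" using x by (intro power_Suc_less_one) auto
  then have P: "?P k = ?P (Suc k) - x ^ Suc k * ?P (Suc k)"
  proof -
    have "?P (Suc k) = ?P k / (1 - x ^ Suc k)" by simp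
    then have "?P (Suc k) * (1 - x ^ Suc k) = ?P k" using xk by (simp only: nonzero_eq_divide_eq)
    then show ?thesis by (simp only: right_diff_distrib mult_1_right mult.commute[of "x ^ Suc k"])
  qed
  have P_pos: "?P (Suc k) \<ge> 0"
    using x by (intro prod_nonneg) (auto simp: power_le_one)
  show ?case
  proof (induction n rule: less_induct)
    case (less n)
    have "card (partitions_upto (Suc k) n) \<le> card (partitions_upto k n \<union>
       (if Suc k \<le> n then (#) (Suc k) ` partitions_upto (Suc k) (n - Suc k) else {}))"
      by (intro card_mono partitions_upto_Suc) (auto simp: finite_partitions_upto)
    also have "\<dots> \<le> card (partitions_upto k n) +
       (if Suc k \<le> n then card (partitions_upto (Suc k) (n - Suc k)) else 0)"
      by (rule order.trans[OF card_Un_le]) (auto intro: card_image_le finite_partitions_upto)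
    finally have "card (partitions_upto (Suc k) n) * x ^ n \<le> card (partitions_upto k n) * x ^ n +
       (if Suc k \<le> n then card (partitions_upto (Suc k) (n - Suc k)) else 0) * x ^ n"
      using x by (simp flip: distrib_right of_nat_add)
    also have "(if Suc k \<le> n then card (partitions_upto (Suc k) (n - Suc k)) else 0) * x ^ n
        \<le> x ^ Suc k * ?P (Suc k)"
    proof (cases "Suc k \<le> n")
      case True
      then have "x ^ n = x ^ Suc k * x ^ (n - Suc k)" by (metis le_add_diff_inverse power_add)
      then show ?thesis
        using True mult_left_mono[OF less.IH[of "n - Suc k"], of "x ^ Suc k"] x
        by (simp add: mult_ac)
    next
      case False
      then show ?thesis using mult_nonneg_nonneg[OF _ P_pos, of "x ^ Suc k"] x
        by (simp del: prod.cl_ivl_Suc power_Suc)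
    qed
    finally show ?case using Suc.IH[of n] P by linarith
  qed
qed

text \<open>
  With \<open>x = exp (- t)\<close>, expand each logarithm as \<open>\<Sum>j. x ^ (i * j) / j\<close> and sum over \<open>i\<close> first: the
  geometric sum is at most \<open>1 / (exp (t * j) - 1) \<le> 1 / (t * j)\<close>, which leaves
  \<open>\<Sum>j. 1 / (t * j\<^sup>2) = pi\<^sup>2 / (6 * t)\<close>.
\<close>

lemma ln_euler_product_le:
  fixes t :: real
  assumes t: "0 < t"
  shows "(\<Sum>i=1..k. - ln (1 - exp (- t) ^ i)) \<le> pi\<^sup>2 / 6 / t"
proof -
  define x where "x = exp (- t)"
  have x: "0 < x" "x < 1" using t by (auto simp: x_def)
  have ln_sums: "(\<lambda>j. (x ^ i) ^ Suc j / Suc j) sums (- ln (1 - x ^ i))" if "i \<ge> 1" for i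
  proof -
    have "x ^ i < 1" using x that by (simp add: power_less_one_iff)
    then have "(\<lambda>j. - ((x ^ i) ^ j) / j) sums ln (1 - x ^ i)"
      using ln_series'[of "- (x ^ i)"] x by simp
    then have "(\<lambda>j. (x ^ i) ^ j / j) sums (- ln (1 - x ^ i))"
      using sums_minus by fastforce
    then show ?thesis by (subst sums_Suc_iff) simp
  qed
  have "(\<lambda>j. \<Sum>i=1..k. (x ^ i) ^ Suc j / Suc j) sums (\<Sum>i=1..k. - ln (1 - x ^ i))"
    by (intro sums_sum ln_sums) auto
  moreover have "(\<lambda>j. 1 / t * (1 / (real j + 1)\<^sup>2)) sums (1 / t * (pi\<^sup>2 / 6))"
    using sums_mult[OF inverse_squares_sums, of "1 / t"] by (simp add: add_ac)
  moreover have "(\<Sum>i=1..k. (x ^ i) ^ Suc j / Suc j) \<le> 1 / t * (1 / (real j + 1)\<^sup>2)" for j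
  proof -
    define y where "y = x ^ Suc j"
    have y: "0 < y" "y < 1" using x by (auto simp: y_def power_Suc_less_one simp del: power_Suc)
    have y_exp: "y = exp (- (t * Suc j))"
      unfolding y_def x_def by (simp flip: exp_of_nat_mult add: mult_ac del: power_Suc)
    have "(\<Sum>i=1..k. y ^ i) = (y - y ^ Suc k) / (1 - y)"
      using sum_gp_multiplied[of 1 k y] y by (cases "k = 0") (simp_all add: field_simps)
    also have "\<dots> \<le> y / (1 - y)" using y by (intro divide_right_mono) auto
    also have "\<dots> = 1 / (exp (t * Suc j) - 1)"
      unfolding y_exp exp_minus using t by (simp add: field_simps)
    also have "\<dots> \<le> 1 / (t * Suc j)"
    proof (rule divide_left_mono)
      show "t * Suc j \<le> exp (t * Suc j) - 1"
        using exp_ge_add_one_self[of "t * Suc j"] by linarith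
      show "0 < (exp (t * Suc j) - 1) * (t * Suc j)" using t by simp
    qed simp
    finally have "(\<Sum>i=1..k. y ^ i) / Suc j \<le> 1 / (t * Suc j) / Suc j"
      by (rule divide_right_mono) simp
    moreover have "(x ^ i) ^ Suc j = y ^ i" for i
      unfolding y_def by (metis power_mult mult.commute)
    ultimately have "(\<Sum>i=1..k. (x ^ i) ^ Suc j / Suc j) \<le> 1 / (t * Suc j) / Suc j"
      by (simp only: sum_divide_distrib)
    also have "\<dots> = 1 / t * (1 / (real j + 1)\<^sup>2)" by (simp add: power2_eq_square add.commute)
    finally show ?thesis .
  qed
  ultimately have "(\<Sum>i=1..k. - ln (1 - x ^ i)) \<le> 1 / t * (pi\<^sup>2 / 6)"
    by (rule sums_le[rotated])
  then show ?thesis by (simp add: x_def)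
qed

lemma partitions_eq_upto: "partitions n = partitions_upto n n"
proof -
  have "\<forall>x\<in>set l. x \<le> n" if "l \<in> partitions n" for l
  proof
    fix x assume "x \<in> set l"
    then have "x \<le> sum_list l" by (simp add: member_le_sum_list)
    then show "x \<le> n" using that by (simp add: partitions_def)
  qed
  then show ?thesis unfolding partitions_upto_def by blast
qed

text \<open>
  The generating function and the bound on its logarithm give \<open>exp (n * t + pi\<^sup>2 / (6 * t))\<close> for every \<open>t > 0\<close>.
\<close>

lemma card_partitions_le: "card (partitions n) \<le> exp (2 * c1 * sqrt n)"
proof (cases "n = 0")
  case True
  then show ?thesis
    using card_partitions_upto_le[of "1 / 2" 0 0] partitions_eq_upto[of 0] by simp
next
  case False
  \<comment> \<open>This value makes the two summands of \<open>n * t + pi\<^sup>2 / (6 * t)\<close> equal, hence their sum minimal.\<close>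
  define t where "t = c1 / sqrt n"
  have c1: "c1 > 0" "c1\<^sup>2 = pi\<^sup>2 / 6" by (auto simp: c1_def power_mult_distrib)
  have t: "t > 0" using c1 False by (simp add: t_def)
  define x where "x = exp (- t)"
  have x: "0 < x" "x < 1" using t by (auto simp: x_def)
  have "card (partitions n) * x ^ n \<le> (\<Prod>i=1..n. 1 / (1 - x ^ i))"
    using card_partitions_upto_le[OF x, of n n] by (simp only: partitions_eq_upto[of n])
  also have "\<dots> = exp (\<Sum>i=1..n. - ln (1 - x ^ i))"
    unfolding exp_sum[OF finite_atLeastAtMost]
  proof (intro prod.cong refl)
    fix i assume "i \<in> {1..n}"
    then have "x ^ i < 1" using x by (auto simp: power_less_one_iff)
    then show "1 / (1 - x ^ i) = exp (- ln (1 - x ^ i))" by (simp add: exp_minus field_simps)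
  qed
  also have "\<dots> \<le> exp (pi\<^sup>2 / 6 / t)" using ln_euler_product_le[OF t] by (simp add: x_def)
  also have "pi\<^sup>2 / 6 / t = c1 * sqrt n"
    unfolding c1(2)[symmetric] using c1(1) by (simp add: t_def power2_eq_square)
  finally have "card (partitions n) * x ^ n * exp (n * t) \<le> exp (c1 * sqrt n) * exp (n * t)"
    by (intro mult_right_mono) auto
  moreover have "x ^ n * exp (n * t) = 1"
    unfolding x_def exp_of_nat_mult[symmetric] exp_add[symmetric] by simp
  moreover have "n * t = c1 * sqrt n"
    using False by (simp add: t_def field_simps)
  moreover have "exp (c1 * sqrt n) * exp (c1 * sqrt n) = exp (2 * c1 * sqrt n)"
    unfolding exp_add[symmetric] by simp
  ultimately show ?thesis by (simp only: mult.assoc mult_1_right)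
qed

section \<open>Young diagrams as down-closed sets\<close>

lemma downset_nat:
  assumes "finite (A :: nat set)" and "\<And>i j. j \<in> A \<Longrightarrow> i \<le> j \<Longrightarrow> i \<in> A"
  shows "A = {..<card A}"
proof -
  define k where "k = (LEAST k. k \<notin> A)"
  have ex: "\<exists>k. k \<notin> A"
    using assms(1) ex_new_if_finite[OF infinite_UNIV_nat] by blast
  have "k \<notin> A" unfolding k_def using ex by (rule LeastI_ex)
  moreover have "i \<in> A" if "i < k" for i
    using that not_less_Least unfolding k_def by blast
  ultimately have "A = {..<k}" using assms(2) by (auto simp: not_less) (meson not_less)
  then show ?thesis by simp
qed

text \<open>
  Partitions as finite down-closed sets of cells: containment is then plain inclusion, and the meet
  and join in Young's lattice are intersection and union.
\<close>

definition diagrams :: "nat \<Rightarrow> (nat \<times> nat) set set" where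
  "diagrams n = {Y. finite Y \<and> card Y = n \<and>
     (\<forall>i j i' j'. (i, j) \<in> Y \<longrightarrow> i' \<le> i \<longrightarrow> j' \<le> j \<longrightarrow> (i', j') \<in> Y)}"

definition row_length :: "(nat \<times> nat) set \<Rightarrow> nat \<Rightarrow> nat" where
  "row_length Y i = card {j. (i, j) \<in> Y}"

lemma diagramsD:
  assumes "Y \<in> diagrams n"
  shows "finite Y" "card Y = n"
    "\<And>i j i' j'. (i, j) \<in> Y \<Longrightarrow> i' \<le> i \<Longrightarrow> j' \<le> j \<Longrightarrow> (i', j') \<in> Y"
  using assms unfolding diagrams_def by blast+

lemma mem_iff_row_length:
  assumes "Y \<in> diagrams n"
  shows "(i, j) \<in> Y \<longleftrightarrow> j < row_length Y i"
proof -
  have "{j. (i, j) \<in> Y} \<subseteq> snd ` Y" by force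
  then have "finite {j. (i, j) \<in> Y}"
    using diagramsD(1)[OF assms] finite_subset by blast
  then have "{j. (i, j) \<in> Y} = {..<row_length Y i}"
    unfolding row_length_def by (rule downset_nat) (use diagramsD(3)[OF assms] in blast)
  then show ?thesis by blast
qed

lemma row_length_antimono:
  assumes "Y \<in> diagrams n" and "i \<le> i'"
  shows "row_length Y i' \<le> row_length Y i"
proof (rule ccontr)
  assume "\<not> row_length Y i' \<le> row_length Y i"
  then have "(i', row_length Y i) \<in> Y" by (simp add: mem_iff_row_length[OF assms(1)])
  then have "(i, row_length Y i) \<in> Y" using diagramsD(3)[OF assms(1)] assms(2) by blast
  then show False by (simp add: mem_iff_row_length[OF assms(1)])
qed

lemma card_young_diagram: "card (young_diagram l) = sum_list l"
proof -
  have "young_diagram l = (SIGMA i : {..<length l}. {..<l ! i})"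
    by (auto simp: young_diagram_def)
  then show ?thesis by (simp add: sum_list_sum_nth atLeast0LessThan)
qed

lemma young_diagram_mem_diagrams:
  assumes "l \<in> partitions n"
  shows "young_diagram l \<in> diagrams n"
proof -
  have "finite (young_diagram l)"
    using finite_skew_diagram[of l "[]"] by (simp add: skew_diagram_def young_diagram_def)
  moreover have "l ! i \<le> l ! i'" if "i' \<le> i" "i < length l" for i i'
    using assms that by (cases "i' = i") (auto simp: partitions_def sorted_wrt_iff_nth_less)
  then have "(i', j') \<in> young_diagram l"
    if "(i, j) \<in> young_diagram l" "i' \<le> i" "j' \<le> j" for i j i' j'
    using that unfolding young_diagram_def by (fastforce dest: order.strict_trans2)
  moreover have "card (young_diagram l) = n"
    using assms by (simp add: card_young_diagram partitions_def)
  ultimately show ?thesis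
    unfolding diagrams_def by blast
qed

lemma inj_on_young_diagram: "inj_on young_diagram (partitions n)"
proof (rule inj_onI)
  fix l u
  assume l: "l \<in> partitions n" and u: "u \<in> partitions n" and eq: "young_diagram l = young_diagram u"
  have mem: "i < length l \<and> j < l ! i \<longleftrightarrow> i < length u \<and> j < u ! i" for i j
    using eq by (auto simp: young_diagram_def set_eq_iff)
  have "i < length l \<longleftrightarrow> i < length u" for i
    using mem[of i 0] l u by (auto simp: partitions_def all_set_conv_all_nth)
  then have len: "length l = length u" by (metis less_irrefl linorder_less_linear)
  show "l = u"
  proof (rule nth_equalityI)
    show "l ! i = u ! i" if "i < length l" for i
      using mem[of i] that len by (metis less_irrefl linorder_less_linear)
  qed (rule len)
qed

text \<open>
  For surjectivity, a down-closed set is recovered from its nonempty rows, which form an initial segment since the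
  first column is down-closed.
\<close>

lemma bij_betw_young_diagram: "bij_betw young_diagram (partitions n) (diagrams n)"
  unfolding bij_betw_def
proof (intro conjI inj_on_young_diagram equalityI subsetI)
  fix Y assume "Y \<in> young_diagram ` partitions n"
  then show "Y \<in> diagrams n" using young_diagram_mem_diagrams by blast
next
  fix Y assume Y: "Y \<in> diagrams n"
  define h where "h = card {i. (i, 0) \<in> Y}"
  have "{i. (i, 0) \<in> Y} \<subseteq> fst ` Y" by force
  then have "finite {i. (i, 0) \<in> Y}" using diagramsD(1)[OF Y] finite_subset by blast
  then have "{i. (i, 0) \<in> Y} = {..<h}"
    unfolding h_def by (rule downset_nat) (use diagramsD(3)[OF Y] in blast)
  then have h: "0 < row_length Y i \<longleftrightarrow> i < h" for i
    using mem_iff_row_length[OF Y, of i 0] by (metis lessThan_iff mem_Collect_eq)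
  define l where "l = map (row_length Y) [0..<h]"
  have yl: "young_diagram l = Y"
  proof -
    have "(i, j) \<in> young_diagram l \<longleftrightarrow> (i, j) \<in> Y" for i j
      using h[of i] mem_iff_row_length[OF Y, of i j] by (auto simp: young_diagram_def l_def)
    then show ?thesis by auto
  qed
  have "sum_list l = n" using card_young_diagram[of l] diagramsD(2)[OF Y] yl by simp
  moreover have "sorted_wrt (\<ge>) l"
    by (auto simp: l_def sorted_wrt_iff_nth_less intro!: row_length_antimono[OF Y])
  ultimately have "l \<in> partitions n"
    using h by (auto simp: partitions_def l_def)
  then show "Y \<in> young_diagram ` partitions n" using yl by blast
qed

lemma finite_diagrams: "finite (diagrams n)"
  using bij_betw_finite[OF bij_betw_young_diagram] finite_partitions by blast

section \<open>Covers in the lattice of diagrams\<close>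

definition lower_covers :: "(nat \<times> nat) set \<Rightarrow> (nat \<times> nat) set set" where
  "lower_covers L = {K \<in> diagrams (card L - 1). K \<subset> L}"

definition upper_covers :: "(nat \<times> nat) set \<Rightarrow> (nat \<times> nat) set set" where
  "upper_covers K = {L \<in> diagrams (Suc (card K)). K \<subset> L}"

lemma finite_lower_covers: "finite (lower_covers L)"
  and finite_upper_covers: "finite (upper_covers K)"
  by (simp_all add: lower_covers_def upper_covers_def finite_diagrams)

text \<open>
  Down-closedness of the smaller set forbids cells to the right of the removed one and below it:
  it must be the last cell of its row, and the next row must be too short to reach below it.
\<close>

lemma lower_covers_eq:
  assumes Y: "Y \<in> diagrams n"
  shows "lower_covers Y = (\<lambda>i. Y - {(i, row_length Y i - 1)}) ` {i. row_length Y (Suc i) < row_length Y i}"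
    (is "_ = ?f ` ?I")
proof (intro equalityI subsetI)
  note mem = mem_iff_row_length[OF Y] and D = diagramsD[OF Y]
  fix K assume "K \<in> lower_covers Y"
  then have K: "K \<in> diagrams (card Y - 1)" "K \<subset> Y" by (auto simp: lower_covers_def)
  note KD = diagramsD[OF K(1)]
  have "Y \<noteq> {}" using K by blast
  then have "0 < card Y" using D(1) by (simp add: card_gt_0_iff)
  then have "card (Y - K) = 1"
    using card_Diff_subset[of K Y] K KD D(1) by simp
  then obtain i j where ij: "Y - K = {(i, j)}" by (metis card_1_singletonE surj_pair)
  then have in_iff: "(i', j') \<in> K \<longleftrightarrow> (i', j') \<in> Y \<and> (i', j') \<noteq> (i, j)" for i' j'
    using K(2) by blast
  have "j < row_length Y i" using ij mem by blast
  have "(i, Suc j) \<notin> Y" "(Suc i, j) \<notin> Y"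
    using in_iff[of i "Suc j"] in_iff[of "Suc i" j] KD(3)[of i "Suc j" i j]
      KD(3)[of "Suc i" j i j] in_iff[of i j] by auto
  then have "j = row_length Y i - 1" "row_length Y (Suc i) < row_length Y i"
    using \<open>j < row_length Y i\<close> by (auto simp: mem)
  moreover have "K = Y - {(i, j)}" using ij K(2) by blast
  ultimately show "K \<in> ?f ` ?I" by blast
next
  note mem = mem_iff_row_length[OF Y] and D = diagramsD[OF Y]
  fix K assume "K \<in> ?f ` ?I"
  then obtain i where i: "row_length Y (Suc i) < row_length Y i"
    and K: "K = Y - {(i, row_length Y i - 1)}" by blast
  have c: "(i, row_length Y i - 1) \<in> Y" using i by (simp add: mem)
  have "(i', j') \<in> K" if "(i1, j1) \<in> K" "i' \<le> i1" "j' \<le> j1" for i' j' i1 j1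
  proof -
    have 1: "(i1, j1) \<in> Y" using that(1) K by blast
    have "(i', j') \<noteq> (i, row_length Y i - 1)"
    proof
      assume e: "(i', j') = (i, row_length Y i - 1)"
      show False
      proof (cases "i1 = i")
        case True
        then show ?thesis using 1 that e K by (auto simp: mem)
      next
        case False
        then have "row_length Y i1 \<le> row_length Y (Suc i)"
          using that e by (intro row_length_antimono[OF Y]) auto
        then show ?thesis using 1 that e i by (auto simp: mem)
      qed
    qed
    then show ?thesis using D(3)[OF 1 that(2,3)] K by blast
  qed
  moreover have "card K = card Y - 1" using K c D(1) by simp
  ultimately have "K \<in> diagrams (card Y - 1)"
    unfolding diagrams_def using K D(1) by blast
  then show "K \<in> lower_covers Y" using K c by (auto simp: lower_covers_def)
qed

text \<open>
  Down-closedness of the larger set requires the cells to the left of the new one and above it: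
  the new cell extends its row by one, and the previous row, if any, must already be longer.
\<close>

lemma upper_covers_eq:
  assumes Y: "Y \<in> diagrams n"
  shows "upper_covers Y =
    (\<lambda>i. insert (i, row_length Y i) Y) ` {i. i = 0 \<or> row_length Y i < row_length Y (i - 1)}"
    (is "_ = ?f ` ?I")
proof (intro equalityI subsetI)
  note mem = mem_iff_row_length[OF Y] and D = diagramsD[OF Y]
  fix L assume "L \<in> upper_covers Y"
  then have L: "L \<in> diagrams (Suc (card Y))" "Y \<subset> L" by (auto simp: upper_covers_def)
  note LD = diagramsD[OF L(1)]
  have "card (L - Y) = 1"
    using card_Diff_subset[of Y L] L LD D(1) by simp
  then obtain i j where ij: "L - Y = {(i, j)}" by (metis card_1_singletonE surj_pair)
  then have in_iff: "(i', j') \<in> L \<longleftrightarrow> (i', j') \<in> Y \<or> (i', j') = (i, j)" for i' j'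
    using L(2) by blast
  have j1: "row_length Y i \<le> j" using ij mem by (metis DiffD2 insertI1 not_le)
  have "(i, row_length Y i) \<in> L" using LD(3)[of i j i] in_iff[of i j] j1 by simp
  then have j: "j = row_length Y i" using in_iff mem by auto
  have "row_length Y i < row_length Y (i - 1)" if "i \<noteq> 0"
  proof -
    have "(i - 1, j) \<in> L" using LD(3)[of i j "i - 1" j] in_iff[of i j] by simp
    then have "(i - 1, j) \<in> Y" using in_iff[of "i - 1" j] that by (cases i) auto
    then show ?thesis using mem j by blast
  qed
  moreover have "L = insert (i, j) Y" using ij L(2) by blast
  ultimately show "L \<in> ?f ` ?I" using j by (intro image_eqI[of _ _ i]) auto
next
  note mem = mem_iff_row_length[OF Y] and D = diagramsD[OF Y]
  fix L assume "L \<in> ?f ` ?I"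
  then obtain i where i: "i = 0 \<or> row_length Y i < row_length Y (i - 1)"
    and L: "L = insert (i, row_length Y i) Y" by blast
  have c: "(i, row_length Y i) \<notin> Y" by (simp add: mem)
  have "(i', j') \<in> L" if "(i1, j1) \<in> L" "i' \<le> i1" "j' \<le> j1" for i' j' i1 j1
  proof (cases "(i1, j1) \<in> Y")
    case True
    then show ?thesis using D(3) that L by blast
  next
    case False
    then have e: "i1 = i" "j1 = row_length Y i" using that L by auto
    show ?thesis
    proof (cases "i' = i")
      case True
      then show ?thesis using that e L mem by auto
    next
      case False
      then have "row_length Y (i - 1) \<le> row_length Y i'"
        using that e by (intro row_length_antimono[OF Y]) auto
      then have "(i', j') \<in> Y" using False e that i mem by auto
      then show ?thesis using L by blast
    qed
  qed
  moreover have "card L = Suc (card Y)" using L c D(1) by simp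
  ultimately have "L \<in> diagrams (Suc (card Y))"
    unfolding diagrams_def using L D(1) by blast
  then show "L \<in> upper_covers Y" using L c by (auto simp: upper_covers_def)
qed

text \<open>
  Row \<open>Suc i\<close> can be extended exactly if row \<open>i\<close> can be shortened, and row \<open>0\<close> can always be
  extended: this is the one surplus cell.
\<close>

lemma card_upper_covers:
  assumes Y: "Y \<in> diagrams n"
  shows "card (upper_covers Y) = Suc (card (lower_covers Y))"
proof -
  let ?I = "{i. row_length Y (Suc i) < row_length Y i}"
  note mem = mem_iff_row_length[OF Y]
  have "?I \<subseteq> fst ` Y"
  proof
    fix i assume "i \<in> ?I"
    then have "(i, 0) \<in> Y" by (simp add: mem)
    then show "i \<in> fst ` Y" by force
  qed
  then have fin: "finite ?I" using diagramsD(1)[OF Y] finite_subset by blast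
  have rows: "{i. i = 0 \<or> row_length Y i < row_length Y (i - 1)} = insert 0 (Suc ` ?I)"
    (is "?J = _")
    by (auto simp: image_iff) (metis Suc_pred not_gr_zero)
  have "inj_on (\<lambda>i. insert (i, row_length Y i) Y) ?J"
  proof (rule inj_onI)
    fix i i' assume "insert (i, row_length Y i) Y = insert (i', row_length Y i') Y"
    moreover have "(i, row_length Y i) \<notin> Y" by (simp add: mem)
    ultimately show "i = i'" by blast
  qed
  moreover have "inj_on (\<lambda>i. Y - {(i, row_length Y i - 1)}) ?I"
  proof (rule inj_onI)
    fix i i' assume "i \<in> ?I" and eq: "Y - {(i, row_length Y i - 1)} = Y - {(i', row_length Y i' - 1)}"
    then have "(i, row_length Y i - 1) \<in> Y" by (simp add: mem)
    with eq show "i = i'" by blast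
  qed
  ultimately have "card (upper_covers Y) = card ?J" "card (lower_covers Y) = card ?I"
    by (simp_all add: upper_covers_eq[OF Y] lower_covers_eq[OF Y] card_image)
  moreover have "card ?J = Suc (card ?I)"
    unfolding rows using fin by (simp add: card_image)
  ultimately show ?thesis by simp
qed

section \<open>The up and down operators\<close>

definition up :: "((nat \<times> nat) set \<Rightarrow> real) \<Rightarrow> (nat \<times> nat) set \<Rightarrow> real" where
  "up v L = (\<Sum>K\<in>lower_covers L. v K)"

definition down :: "((nat \<times> nat) set \<Rightarrow> real) \<Rightarrow> (nat \<times> nat) set \<Rightarrow> real" where
  "down v K = (\<Sum>L\<in>upper_covers K. v L)"

lemma diagrams_Un_Int:
  assumes "K \<in> diagrams k" "L \<in> diagrams l"
  shows "K \<union> L \<in> diagrams (card (K \<union> L))" "K \<inter> L \<in> diagrams (card (K \<inter> L))"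
proof -
  note K = diagramsD[OF assms(1)] and L = diagramsD[OF assms(2)]
  have "(i', j') \<in> K \<union> L" if "(i, j) \<in> K \<union> L" "i' \<le> i" "j' \<le> j" for i j i' j'
    using K(3)[OF _ that(2,3)] L(3)[OF _ that(2,3)] that(1) by blast
  then show "K \<union> L \<in> diagrams (card (K \<union> L))"
    unfolding diagrams_def using K(1) L(1) by blast
  have "(i', j') \<in> K \<inter> L" if "(i, j) \<in> K \<inter> L" "i' \<le> i" "j' \<le> j" for i j i' j'
    using K(3)[OF _ that(2,3)] L(3)[OF _ that(2,3)] that(1) by blast
  then show "K \<inter> L \<in> diagrams (card (K \<inter> L))"
    unfolding diagrams_def using K(1) by blast
qed

lemma lower_covers_at:
  assumes "L \<in> diagrams (Suc n)"
  shows "lower_covers L = {K \<in> diagrams n. K \<subset> L}"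
  by (simp add: lower_covers_def diagramsD(2)[OF assms])

lemma upper_covers_at:
  assumes "K \<in> diagrams n"
  shows "upper_covers K = {L \<in> diagrams (Suc n). K \<subset> L}"
  by (simp add: upper_covers_def diagramsD(2)[OF assms])

lemma lower_covers_level:
  assumes "L \<in> diagrams n" "K \<in> lower_covers L"
  obtains k where "n = Suc k" "K \<in> diagrams k" "K \<subset> L"
proof -
  have K: "K \<in> diagrams (n - 1)" "K \<subset> L"
    using assms(2) by (simp_all add: lower_covers_def diagramsD(2)[OF assms(1)])
  moreover have "card K < card L"
    using K(2) diagramsD(1)[OF assms(1)] by (rule psubset_card_mono[rotated])
  then have "n = Suc (n - 1)" using diagramsD(2)[OF assms(1)] by simp
  ultimately show thesis using that by blast
qed

text \<open>
  For two different diagrams of the same size, a common upper cover can only be their union, and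
  it exists exactly if their intersection is a common lower cover. This lemma and the next one give
  the two directions.
\<close>

lemma exchange_via_union:
  assumes M: "M \<in> diagrams n" and L: "L \<in> upper_covers M" and M': "M' \<in> lower_covers L - {M}"
  shows "M \<inter> M' \<in> lower_covers M" "M' \<in> upper_covers (M \<inter> M') - {M}" "M \<union> M' = L"
proof -
  have L': "L \<in> diagrams (Suc n)" "M \<subset> L" using L by (auto simp: upper_covers_at[OF M])
  have m: "M' \<in> diagrams n" "M' \<subset> L" "M' \<noteq> M" using M' by (auto simp: lower_covers_at[OF L'(1)])
  note fin = diagramsD(1)[OF M] diagramsD(1)[OF m(1)] diagramsD(1)[OF L'(1)]
  note cards = diagramsD(2)[OF M] diagramsD(2)[OF m(1)] diagramsD(2)[OF L'(1)]
  have ne: "\<not> M' \<subseteq> M" using card_subset_eq[of M M'] fin cards m by auto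
  then have ne': "\<not> M \<subseteq> M'" using card_subset_eq[of M' M] fin cards m by auto
  have "M \<subset> M \<union> M'" using ne by blast
  then have "card M < card (M \<union> M')" using fin by (intro psubset_card_mono) auto
  moreover have sub: "M \<union> M' \<subseteq> L" using L' m by blast
  ultimately show un: "M \<union> M' = L"
    using card_mono[OF fin(3) sub] cards fin by (intro card_subset_eq) auto
  have "card (M \<inter> M') = n - 1" "n \<noteq> 0"
    using card_Un_Int[OF fin(1,2)] un cards by (auto simp: fin)
  then obtain k where k: "n = Suc k" "M \<inter> M' \<in> diagrams k"
    using diagrams_Un_Int(2)[OF M m(1)] by (cases n) auto
  show "M \<inter> M' \<in> lower_covers M"
    using k M ne' by (auto simp: lower_covers_at)
  show "M' \<in> upper_covers (M \<inter> M') - {M}"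
    using k m ne by (auto simp: upper_covers_at[OF k(2)])
qed

lemma exchange_via_intersection:
  assumes M: "M \<in> diagrams n" and K: "K \<in> lower_covers M" and M': "M' \<in> upper_covers K - {M}"
  shows "M \<union> M' \<in> upper_covers M" "M' \<in> lower_covers (M \<union> M') - {M}" "M \<inter> M' = K"
proof -
  obtain k where k: "n = Suc k" "K \<in> diagrams k" "K \<subset> M"
    using lower_covers_level[OF M K] .
  have m: "M' \<in> diagrams n" "K \<subset> M'" "M' \<noteq> M"
    using M' k by (auto simp: upper_covers_at[OF k(2)])
  note fin = diagramsD(1)[OF M] diagramsD(1)[OF m(1)] diagramsD(1)[OF k(2)]
  note cards = diagramsD(2)[OF M] diagramsD(2)[OF m(1)] diagramsD(2)[OF k(2)]
  have ne: "\<not> M' \<subseteq> M" using card_subset_eq[of M M'] fin cards m by auto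
  then have ne': "\<not> M \<subseteq> M'" using card_subset_eq[of M' M] fin cards m by auto
  have "M \<inter> M' \<subset> M" using ne' by blast
  then have "card (M \<inter> M') < card M" using fin by (intro psubset_card_mono) auto
  moreover have sub: "K \<subseteq> M \<inter> M'" using k m by blast
  ultimately show int: "M \<inter> M' = K"
    using card_mono[OF _ sub] cards fin k by (intro card_subset_eq[symmetric]) auto
  have "card (M \<union> M') = Suc n"
    using card_Un_Int[OF fin(1,2)] int cards k by simp
  then have un: "M \<union> M' \<in> diagrams (Suc n)"
    using diagrams_Un_Int(1)[OF M m(1)] by simp
  show "M \<union> M' \<in> upper_covers M"
    using un ne by (auto simp: upper_covers_at[OF M])
  show "M' \<in> lower_covers (M \<union> M') - {M}"
    using m ne' by (auto simp: lower_covers_at[OF un])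
qed

text \<open>
  The commutation relation \<open>D U = U D + I\<close> of Young's lattice. Off the diagonal, pairs of diagrams have
  as many common upper as common lower covers; on the diagonal, the surplus addable cell contributes
  the identity.
\<close>

lemma down_up:
  assumes M: "M \<in> diagrams n"
  shows "down (up v) M = up (down v) M + v M"
proof -
  have "down (up v) M = (\<Sum>L\<in>upper_covers M. v M + (\<Sum>M'\<in>lower_covers L - {M}. v M'))"
    unfolding down_def up_def
  proof (intro sum.cong refl)
    fix L assume "L \<in> upper_covers M"
    then have "M \<in> lower_covers L"
      using M by (auto simp: upper_covers_at[OF M] lower_covers_at)
    then show "sum v (lower_covers L) = v M + sum v (lower_covers L - {M})"
      by (intro sum.remove finite_lower_covers)
  qed
  also have "\<dots> = card (upper_covers M) * v M +
      (\<Sum>(L, M')\<in>(SIGMA L:upper_covers M. lower_covers L - {M}). v M')"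
    by (simp add: sum.distrib sum.Sigma finite_upper_covers finite_lower_covers)
  finally have 1: "down (up v) M = card (upper_covers M) * v M +
      (\<Sum>(L, M')\<in>(SIGMA L:upper_covers M. lower_covers L - {M}). v M')" .
  have "up (down v) M = (\<Sum>K\<in>lower_covers M. v M + (\<Sum>M'\<in>upper_covers K - {M}. v M'))"
    unfolding down_def up_def
  proof (intro sum.cong refl)
    fix K assume "K \<in> lower_covers M"
    with M obtain k where "n = Suc k" "K \<in> diagrams k" "K \<subset> M" by (rule lower_covers_level)
    then have "M \<in> upper_covers K"
      using M by (auto simp: upper_covers_at)
    then show "sum v (upper_covers K) = v M + sum v (upper_covers K - {M})"
      by (intro sum.remove finite_upper_covers)
  qed
  also have "\<dots> = card (lower_covers M) * v M +
      (\<Sum>(K, M')\<in>(SIGMA K:lower_covers M. upper_covers K - {M}). v M')"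
    by (simp add: sum.distrib sum.Sigma finite_upper_covers finite_lower_covers)
  finally have 2: "up (down v) M = card (lower_covers M) * v M +
      (\<Sum>(K, M')\<in>(SIGMA K:lower_covers M. upper_covers K - {M}). v M')" .
  have 3: "(\<Sum>(L, M')\<in>(SIGMA L:upper_covers M. lower_covers L - {M}). v M') =
      (\<Sum>(K, M')\<in>(SIGMA K:lower_covers M. upper_covers K - {M}). v M')"
    by (rule sum.reindex_bij_witness
        [of _ "\<lambda>(K, M'). (M \<union> M', M')" "\<lambda>(L, M'). (M \<inter> M', M')"])
      (use exchange_via_union[OF M] exchange_via_intersection[OF M] in \<open>fastforce+\<close>)
  show ?thesis
    unfolding 1 2 3 card_upper_covers[OF M] by (simp add: algebra_simps)
qed

lemma up_down_adjoint:
  "(\<Sum>L\<in>diagrams (Suc n). up v L * w L) = (\<Sum>K\<in>diagrams n. v K * down w K)"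
proof -
  have "(\<Sum>L\<in>diagrams (Suc n). up v L * w L) =
      (\<Sum>L\<in>diagrams (Suc n). \<Sum>K | K \<in> diagrams n \<and> K \<subset> L. v K * w L)"
  proof (rule sum.cong[OF refl])
    fix L assume "L \<in> diagrams (Suc n)"
    then show "up v L * w L = (\<Sum>K | K \<in> diagrams n \<and> K \<subset> L. v K * w L)"
      unfolding up_def sum_distrib_right by (subst lower_covers_at) (assumption, rule refl)
  qed
  also have "\<dots> = (\<Sum>K\<in>diagrams n. \<Sum>L | L \<in> diagrams (Suc n) \<and> K \<subset> L. v K * w L)"
    by (rule sum.swap_restrict[OF finite_diagrams finite_diagrams])
  also have "\<dots> = (\<Sum>K\<in>diagrams n. v K * down w K)"
  proof (rule sum.cong[OF refl])
    fix K assume "K \<in> diagrams n"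
    then show "(\<Sum>L | L \<in> diagrams (Suc n) \<and> K \<subset> L. v K * w L) = v K * down w K"
      unfolding down_def sum_distrib_left by (subst upper_covers_at) (assumption, rule refl)
  qed
  finally show ?thesis .
qed

text \<open>
  Adjointness and the commutation relation give \<open>\<parallel>U v\<parallel>\<^sup>2 = \<parallel>D v\<parallel>\<^sup>2 + \<parallel>v\<parallel>\<^sup>2\<close>. As \<open>D\<close> is the adjoint of
  the operator \<open>U\<close> one level below, it has the same norm, so the squared norm of \<open>U\<close> grows by at most
  one from each level to the next.
\<close>

lemma up_bound:
  fixes v :: "(nat \<times> nat) set \<Rightarrow> real"
  shows "(\<Sum>L\<in>diagrams (Suc n). (up v L)\<^sup>2) \<le> Suc n * (\<Sum>K\<in>diagrams n. (v K)\<^sup>2)"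
proof (induction n arbitrary: v)
  case 0
  have "up (down v) K = 0" if "K \<in> diagrams 0" for K
  proof -
    have "K = {}" using diagramsD(1,2)[OF that] by simp
    then show ?thesis by (simp add: up_def lower_covers_def)
  qed
  then have "(\<Sum>L\<in>diagrams 1. (up v L)\<^sup>2) = (\<Sum>K\<in>diagrams 0. (v K)\<^sup>2)"
    using up_down_adjoint[of v "up v" 0] by (simp add: down_up power2_eq_square cong: sum.cong)
  then show ?case by simp
next
  case (Suc n)
  define N where "N = (\<Sum>K\<in>diagrams (Suc n). (v K)\<^sup>2)"
  define D where "D = (\<Sum>K\<in>diagrams n. (down v K)\<^sup>2)"
  have "N \<ge> 0" "D \<ge> 0" by (auto simp: N_def D_def sum_nonneg)
  have D: "D = (\<Sum>L\<in>diagrams (Suc n). up (down v) L * v L)"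
    by (simp add: up_down_adjoint D_def power2_eq_square)
  \<comment> \<open>The norm bound passes to the adjoint: \<open>\<parallel>D v\<parallel>\<^sup>2 = \<langle>U D v, v\<rangle> \<le> \<parallel>U D v\<parallel> \<parallel>v\<parallel>\<close>.\<close>
  have "D * D \<le> (\<Sum>L\<in>diagrams (Suc n). (up (down v) L)\<^sup>2) * N"
    using Cauchy_Schwarz_ineq_sum[of "up (down v)" v "diagrams (Suc n)"]
    unfolding D[symmetric] N_def by (simp add: power2_eq_square)
  also have "\<dots> \<le> (Suc n * D) * N"
    using Suc.IH[of "down v"] \<open>N \<ge> 0\<close> unfolding D_def by (intro mult_right_mono)
  finally have "D * D \<le> D * (Suc n * N)" by (simp only: mult_ac)
  then have le: "D \<le> Suc n * N"
    using \<open>D \<ge> 0\<close> \<open>N \<ge> 0\<close> by (cases "D = 0") (simp, simp add: mult_le_cancel_left)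
  have "(\<Sum>L\<in>diagrams (Suc (Suc n)). (up v L)\<^sup>2) =
      (\<Sum>K\<in>diagrams (Suc n). v K * down (up v) K)"
    using up_down_adjoint[of v "up v" "Suc n"] by (simp add: power2_eq_square)
  also have "\<dots> = (\<Sum>K\<in>diagrams (Suc n). up (down v) K * v K + (v K)\<^sup>2)"
    by (intro sum.cong refl) (simp add: down_up power2_eq_square algebra_simps)
  also have "\<dots> = D + N" unfolding D N_def by (simp add: sum.distrib)
  also have "\<dots> \<le> Suc (Suc n) * N" using le by (simp add: algebra_simps)
  finally show ?case unfolding N_def .
qed

section \<open>Tableaux and the up operator\<close>

text \<open>
  The notion of tableau depends on the shape only as a set of cells; the recursion below removes
  single cells from it.
\<close>

definition standard_fillings :: "(nat \<times> nat) set \<Rightarrow> (nat \<times> nat \<Rightarrow> nat) set" where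
  "standard_fillings S = {T \<in> extensional S. bij_betw T S {1..card S} \<and>
     (\<forall>i j j'. (i, j) \<in> S \<longrightarrow> (i, j') \<in> S \<longrightarrow> j < j' \<longrightarrow> T (i, j) < T (i, j')) \<and>
     (\<forall>i i' j. (i, j) \<in> S \<longrightarrow> (i', j) \<in> S \<longrightarrow> i < i' \<longrightarrow> T (i, j) < T (i', j))}"

lemma standard_fillingsD:
  assumes "T \<in> standard_fillings S"
  shows "T \<in> extensional S" "bij_betw T S {1..card S}"
    "\<And>i j j'. (i, j) \<in> S \<Longrightarrow> (i, j') \<in> S \<Longrightarrow> j < j' \<Longrightarrow> T (i, j) < T (i, j')"
    "\<And>i i' j. (i, j) \<in> S \<Longrightarrow> (i', j) \<in> S \<Longrightarrow> i < i' \<Longrightarrow> T (i, j) < T (i', j)"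
  using assms unfolding standard_fillings_def by auto

lemma standard_fillingsI:
  assumes "T \<in> extensional S" "bij_betw T S {1..card S}"
    "\<And>i j j'. (i, j) \<in> S \<Longrightarrow> (i, j') \<in> S \<Longrightarrow> j < j' \<Longrightarrow> T (i, j) < T (i, j')"
    "\<And>i i' j. (i, j) \<in> S \<Longrightarrow> (i', j) \<in> S \<Longrightarrow> i < i' \<Longrightarrow> T (i, j) < T (i', j)"
  shows "T \<in> standard_fillings S"
  using assms unfolding standard_fillings_def by auto

lemma skew_SYT_eq_standard_fillings: "skew_SYT l u = standard_fillings (young_diagram l - young_diagram u)"
  by (simp add: skew_SYT_def standard_fillings_def skew_diagram_def)

lemma finite_standard_fillings: "finite S \<Longrightarrow> finite (standard_fillings S)"
proof (rule finite_subset)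
  show "standard_fillings S \<subseteq> S \<rightarrow>\<^sub>E {1..card S}"
    by (auto simp: standard_fillings_def PiE_def bij_betw_def)
qed (simp add: finite_PiE)

lemma standard_fillings_empty: "standard_fillings {} = {\<lambda>_. undefined}"
  by (auto simp: standard_fillings_def bij_betw_def)

lemma standard_fillings_remove:
  assumes S: "finite S" "c \<in> S" and T: "T \<in> standard_fillings S" "T c = card S"
  shows "restrict T (S - {c}) \<in> standard_fillings (S - {c})"
proof (rule standard_fillingsI)
  note TD = standard_fillingsD[OF T(1)]
  have card: "card S = Suc (card (S - {c}))" using S by (rule card.remove)
  have "bij_betw T (S - {c}) ({1..card S} - {T c})"
    unfolding bij_betw_def
  proof
    have inj: "inj_on T S" and img: "T ` S = {1..card S}"
      using TD(2) by (simp_all add: bij_betw_def)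
    show "inj_on T (S - {c})" using inj by (rule inj_on_diff)
    show "T ` (S - {c}) = {1..card S} - {T c}"
      using inj_on_image_set_diff[OF inj, of S "{c}"] S(2) img by simp
  qed
  moreover have "{1..card S} - {T c} = {1..card (S - {c})}" using T(2) card by auto
  ultimately have "bij_betw T (S - {c}) {1..card (S - {c})}" by simp
  then show "bij_betw (restrict T (S - {c})) (S - {c}) {1..card (S - {c})}"
    by (simp only: bij_betw_restrict_eq)
qed (use standard_fillingsD(3,4)[OF T(1)] in auto)

lemma standard_fillings_add:
  assumes S: "finite S" "(a, b) \<in> S" and T: "T \<in> standard_fillings (S - {(a, b)})"
    and corner: "\<And>j. b < j \<Longrightarrow> (a, j) \<notin> S" "\<And>i. a < i \<Longrightarrow> (i, b) \<notin> S"
  shows "T((a, b) := card S) \<in> standard_fillings S"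
proof (rule standard_fillingsI)
  let ?c = "(a, b)" and ?T = "T((a, b) := card S)"
  note TD = standard_fillingsD[OF T]
  have card: "card S = Suc (card (S - {?c}))" using S by (rule card.remove)
  have eq: "S = insert ?c (S - {?c})" "{1..card S} = insert (card S) {1..card (S - {?c})}"
    using S card by auto
  have "bij_betw ?T (S - {?c}) {1..card (S - {?c})}"
    using TD(2) by (subst bij_betw_cong[of _ _ T]) auto
  moreover have "?T ?c = card S" by simp
  ultimately have "bij_betw ?T (insert ?c (S - {?c})) (insert (card S) {1..card (S - {?c})})"
    using notIn_Un_bij_betw[of ?c "S - {?c}" ?T "{1..card (S - {?c})}"] card by auto
  then show "bij_betw ?T S {1..card S}" by (simp only: eq(1)[symmetric] eq(2)[symmetric])
  have lt: "T x < card S" if "x \<in> S - {?c}" for x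
    using bspec[OF bij_betwE[OF TD(2)] that] card by simp
  show "?T (i, j) < ?T (i, j')" if "(i, j) \<in> S" "(i, j') \<in> S" "j < j'" for i j j'
    using that lt[of "(i, j)"] TD(3)[of i j j'] corner(1)[of j'] by auto
  show "?T (i, j) < ?T (i', j)" if "(i, j) \<in> S" "(i', j) \<in> S" "i < i'" for i i' j
    using that lt[of "(i, j)"] TD(4)[of i j i'] corner(2)[of i'] by auto
  show "?T \<in> extensional S"
    using TD(1) S by (auto simp: extensional_def)
qed

lemma lower_covers_conv_corner:
  assumes L: "L \<in> diagrams n"
  shows "L - {(a, b)} \<in> lower_covers L \<longleftrightarrow>
    (a, b) \<in> L \<and> (\<forall>j>b. (a, j) \<notin> L) \<and> (\<forall>i>a. (i, b) \<notin> L)" (is "?A \<longleftrightarrow> ?B")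
proof
  assume A: ?A
  then have c: "(a, b) \<in> L" and K: "L - {(a, b)} \<in> diagrams (card L - 1)"
    by (auto simp: lower_covers_def)
  have "(a, j) \<notin> L" if "b < j" for j
    using diagramsD(3)[OF K, of a j a b] that by auto
  moreover have "(i, b) \<notin> L" if "a < i" for i
    using diagramsD(3)[OF K, of i b a b] that by auto
  ultimately show ?B using c by blast
next
  note LD = diagramsD[OF L]
  assume B: ?B
  have "(i', j') \<in> L - {(a, b)}" if ij: "(i, j) \<in> L - {(a, b)}" "i' \<le> i" "j' \<le> j" for i j i' j'
  proof -
    have "(i', j') \<noteq> (a, b)"
    proof
      assume e: "(i', j') = (a, b)"
      then have "a < i \<or> b < j" using ij by auto
      moreover have "(i, b) \<in> L" "(a, j) \<in> L" using LD(3) ij e by auto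
      ultimately show False using B by blast
    qed
    then show ?thesis using LD(3)[of i j i' j'] ij by blast
  qed
  moreover have "card (L - {(a, b)}) = card L - 1" using B by simp
  ultimately have "L - {(a, b)} \<in> diagrams (card L - 1)"
    unfolding diagrams_def using LD(1) by blast
  then show ?A using B by (auto simp: lower_covers_def)
qed

lemma lower_covers_obtain:
  assumes L: "L \<in> diagrams n" and K: "K \<in> lower_covers L"
  obtains c where "c \<in> L" "K = L - {c}"
proof -
  obtain k where k: "n = Suc k" "K \<in> diagrams k" "K \<subset> L"
    using lower_covers_level[OF L K] .
  have "card (L - K) = 1"
    using card_Diff_subset[of K L] k diagramsD[OF L] diagramsD[OF k(2)] by simp
  then obtain c where "L - K = {c}" by (metis card_1_singletonE)
  then have "c \<in> L" "K = L - {c}" using k(3) by blast+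
  then show thesis by (rule that)
qed

definition skew_count :: "(nat \<times> nat) set \<Rightarrow> (nat \<times> nat) set \<Rightarrow> real" where
  "skew_count M L = (if M \<subseteq> L then card (standard_fillings (L - M)) else 0)"

lemma num_skew_SYT_eq: "num_skew_SYT l u = skew_count (young_diagram u) (young_diagram l)"
  by (simp add: num_skew_SYT_def skew_count_def skew_SYT_eq_standard_fillings)

lemma skew_count_same_size:
  assumes "M \<in> diagrams n" "L \<in> diagrams n"
  shows "skew_count M L = (if L = M then 1 else 0)"
proof -
  have "M \<subseteq> L \<longleftrightarrow> L = M"
    using card_subset_eq[of L M] diagramsD(1,2)[OF assms(1)] diagramsD(1,2)[OF assms(2)] by auto
  then show ?thesis by (simp add: skew_count_def standard_fillings_empty)
qed

text \<open>
  The largest entry of a skew tableau sits in a corner of the outer shape that lies outside the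
  inner one; deleting it leaves a tableau of the smaller shape, and every such tableau arises once.
  Hence \<open>skew_count M\<close> is obtained from the indicator of \<open>M\<close> by iterating \<open>up\<close>.
\<close>

lemma skew_count_Suc:
  assumes M: "M \<in> diagrams m" and L: "L \<in> diagrams (Suc n)" and "m \<le> n"
  shows "skew_count M L = up (skew_count M) L"
proof (cases "M \<subseteq> L")
  case False
  then have "skew_count M K = 0" if "K \<in> lower_covers L" for K
    using that by (auto simp: skew_count_def lower_covers_def)
  then show ?thesis using False by (simp add: up_def skew_count_def)
next
  case True
  let ?S = "L - M"
  note LD = diagramsD[OF L] and MD = diagramsD[OF M]
  have finS: "finite ?S" using LD(1) by simp
  have "card ?S = Suc n - m" using True LD(1,2) MD(1,2) by (simp add: card_Diff_subset)
  then have S_pos: "0 < card ?S" using \<open>m \<le> n\<close> by simp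
  define C where "C = {c \<in> ?S. L - {c} \<in> lower_covers L}"
  have finC: "finite C" using finS by (rule rev_finite_subset) (auto simp: C_def)
  \<comment> \<open>The tableaux are sorted by the cell \<open>c\<close> that holds the largest entry.\<close>
  define A where "A c = {T \<in> standard_fillings ?S. T c = card ?S}" for c
  have cover: "standard_fillings ?S = (\<Union>c\<in>C. A c)"
  proof (intro equalityI subsetI)
    fix T assume T: "T \<in> standard_fillings ?S"
    note TD = standard_fillingsD[OF T]
    obtain c where c: "c \<in> ?S" "T c = card ?S"
      using S_pos bij_betw_imp_surj_on[OF TD(2)] by (metis One_nat_def Suc_leI atLeastAtMost_iff imageE order_refl)
    have le: "T x \<le> card ?S" if "x \<in> ?S" for x
      using bij_betwE[OF TD(2)] that by auto
    obtain a b where ab: "c = (a, b)" by (cases c)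
    \<comment> \<open>A cell of \<open>L\<close> to the right of \<open>c\<close> or below it cannot lie in \<open>M\<close>, so its entry would exceed the maximum.\<close>
    have "(a, j) \<notin> L" if "b < j" for j
    proof
      assume "(a, j) \<in> L"
      moreover have "(a, j) \<notin> M" using MD(3)[of a j a b] that c ab by auto
      ultimately show False using TD(3)[of a b j] le[of "(a, j)"] that c ab by auto
    qed
    moreover have "(i, b) \<notin> L" if "a < i" for i
    proof
      assume "(i, b) \<in> L"
      moreover have "(i, b) \<notin> M" using MD(3)[of i b a b] that c ab by auto
      ultimately show False using TD(4)[of a b i] le[of "(i, b)"] that c ab by auto
    qed
    ultimately have "c \<in> C" using c unfolding C_def ab by (auto simp: lower_covers_conv_corner[OF L])
    then show "T \<in> (\<Union>c\<in>C. A c)" using T c by (auto simp: A_def)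
  qed (auto simp: A_def)
  have disj: "A c \<inter> A c' = {}" if "c \<in> C" "c' \<in> C" "c \<noteq> c'" for c c'
  proof -
    have neq: "T c \<noteq> T c'" if "T \<in> standard_fillings ?S" for T
      using bij_betw_imp_inj_on[OF standard_fillingsD(2)[OF that]] \<open>c \<in> C\<close> \<open>c' \<in> C\<close> \<open>c \<noteq> c'\<close>
      unfolding C_def inj_on_def by blast
    show ?thesis
    proof (rule equals0I)
      fix T assume "T \<in> A c \<inter> A c'"
      then have "T \<in> standard_fillings ?S" "T c = T c'" by (simp_all add: A_def)
      then show False using neq by blast
    qed
  qed
  have "finite (A c)" for c
    unfolding A_def using finite_standard_fillings[OF finS] by simp
  then have "card (standard_fillings ?S) = (\<Sum>c\<in>C. card (A c))"
    unfolding cover using finC disj by (intro card_UN_disjoint) auto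
  also have "\<dots> = (\<Sum>c\<in>C. card (standard_fillings (?S - {c})))"
  proof (intro sum.cong refl)
    fix c assume c: "c \<in> C"
    obtain a b where ab: "c = (a, b)" by (cases c)
    have c': "(a, b) \<in> ?S" "L - {(a, b)} \<in> lower_covers L" using c ab by (auto simp: C_def)
    have "bij_betw (\<lambda>T. restrict T (?S - {c})) (A c) (standard_fillings (?S - {c}))"
    proof (rule bij_betw_byWitness[where f' = "\<lambda>T. T(c := card ?S)"])
      show "\<forall>T\<in>A c. (restrict T (?S - {c}))(c := card ?S) = T"
      proof
        fix T assume "T \<in> A c"
        then have "T \<in> extensional ?S" "T c = card ?S" using standard_fillingsD(1) by (auto simp: A_def)
        then show "(restrict T (?S - {c}))(c := card ?S) = T"
          by (auto simp: fun_eq_iff extensional_def)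
      qed
      show "\<forall>T\<in>standard_fillings (?S - {c}). restrict (T(c := card ?S)) (?S - {c}) = T"
      proof
        fix T assume "T \<in> standard_fillings (?S - {c})"
        then have "T \<in> extensional (?S - {c})" by (rule standard_fillingsD(1))
        then show "restrict (T(c := card ?S)) (?S - {c}) = T"
          by (auto simp: fun_eq_iff extensional_def restrict_def)
      qed
      show "(\<lambda>T. restrict T (?S - {c})) ` A c \<subseteq> standard_fillings (?S - {c})"
        using standard_fillings_remove[OF finS, of c] c'(1) unfolding ab A_def by blast
      have "T(c := card ?S) \<in> standard_fillings ?S" if "T \<in> standard_fillings (?S - {c})" for T
        using that c'(2) unfolding ab lower_covers_conv_corner[OF L]
        by (intro standard_fillings_add finS c'(1)) auto
      then show "(\<lambda>T. T(c := card ?S)) ` standard_fillings (?S - {c}) \<subseteq> A c"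
        by (auto simp: A_def)
    qed
    then show "card (A c) = card (standard_fillings (?S - {c}))" by (rule bij_betw_same_card)
  qed
  finally have card_eq: "card (standard_fillings ?S) = (\<Sum>c\<in>C. card (standard_fillings (?S - {c})))" .
  have "skew_count M L = (\<Sum>c\<in>C. skew_count M (L - {c}))"
  proof -
    have "M \<subseteq> L - {c}" "L - {c} - M = ?S - {c}" if "c \<in> C" for c
      using that True by (auto simp: C_def)
    then have "(\<Sum>c\<in>C. skew_count M (L - {c})) = (\<Sum>c\<in>C. real (card (standard_fillings (?S - {c}))))"
      by (intro sum.cong refl) (simp add: skew_count_def)
    then show ?thesis
      using True by (simp add: skew_count_def card_eq)
  qed
  also have "\<dots> = (\<Sum>K\<in>(\<lambda>c. L - {c}) ` C. skew_count M K)"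
    by (rule sum.reindex_cong[symmetric, where l = "\<lambda>c. L - {c}"])
      (auto simp: inj_on_def C_def)
  \<comment> \<open>The remaining lower covers do not contain \<open>M\<close> and contribute \<open>0\<close>.\<close>
  also have "\<dots> = up (skew_count M) L"
    unfolding up_def
  proof (rule sum.mono_neutral_left[OF finite_lower_covers])
    show "(\<lambda>c. L - {c}) ` C \<subseteq> lower_covers L" by (auto simp: C_def)
    show "\<forall>K\<in>lower_covers L - (\<lambda>c. L - {c}) ` C. skew_count M K = 0"
    proof
      fix K assume K: "K \<in> lower_covers L - (\<lambda>c. L - {c}) ` C"
      then obtain c where c: "c \<in> L" "K = L - {c}" using lower_covers_obtain[OF L] by blast
      then have "c \<in> M" using K by (auto simp: C_def)
      then show "skew_count M K = 0" using c by (auto simp: skew_count_def)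
    qed
  qed
  finally show ?thesis .
qed

section \<open>Bounds for the maximal number of skew tableaux\<close>

lemma diagrams_0: "diagrams 0 = {{}}"
  by (auto simp: diagrams_def)

lemma sum_skew_count_sq_le:
  assumes "M \<in> diagrams m" and "m \<le> n"
  shows "(\<Sum>L\<in>diagrams n. (skew_count M L)\<^sup>2) \<le> fact n / fact m"
  using assms(2)
proof (induction n rule: dec_induct)
  case base
  have "(\<Sum>L\<in>diagrams m. (skew_count M L)\<^sup>2) = (\<Sum>L\<in>diagrams m. if L = M then 1 else 0)"
    by (intro sum.cong refl) (simp add: skew_count_same_size[OF assms(1)])
  then show ?case using assms(1) by (simp add: finite_diagrams)
next
  case (step n)
  have "(\<Sum>L\<in>diagrams (Suc n). (skew_count M L)\<^sup>2) = (\<Sum>L\<in>diagrams (Suc n). (up (skew_count M) L)\<^sup>2)"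
    using step(1) by (intro sum.cong refl) (simp add: skew_count_Suc[OF assms(1)])
  also have "\<dots> \<le> Suc n * (\<Sum>K\<in>diagrams n. (skew_count M K)\<^sup>2)"
    by (rule up_bound)
  also have "\<dots> \<le> Suc n * (fact n / fact m)"
    by (intro mult_left_mono step.IH) simp
  finally show ?case by simp
qed

text \<open>
  A single coefficient of a vector is at most its norm.
\<close>

lemma skew_count_le_sqrt:
  assumes "M \<in> diagrams m" "L \<in> diagrams n" "m \<le> n"
  shows "skew_count M L \<le> sqrt (fact n / fact m)"
proof (rule real_le_rsqrt)
  have "(skew_count M L)\<^sup>2 \<le> (\<Sum>L\<in>diagrams n. (skew_count M L)\<^sup>2)"
    by (rule member_le_sum) (use assms(2) finite_diagrams in auto)
  also have "\<dots> \<le> fact n / fact m" using assms by (intro sum_skew_count_sq_le)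
  finally show "(skew_count M L)\<^sup>2 \<le> fact n / fact m" .
qed

text \<open>
  This is the branching rule for induced representations of symmetric groups in numerical form. It
  follows from the commutation relation, since \<open>skew_count {}\<close> is mapped to itself by \<open>up\<close>.
\<close>

lemma down_skew_count_empty:
  "K \<in> diagrams n \<Longrightarrow> down (skew_count {}) K = Suc n * skew_count {} K"
proof (induction n arbitrary: K)
  case (0 K)
  have "down (skew_count {}) K = down (up (skew_count {})) K"
    unfolding down_def upper_covers_at[OF 0]
    by (intro sum.cong refl) (auto intro!: skew_count_Suc[of _ 0] simp: diagrams_0)
  then show ?case using 0 by (simp add: down_up[OF 0]) (simp add: diagrams_0 up_def lower_covers_def)
next
  case (Suc n K)
  have "down (skew_count {}) K = down (up (skew_count {})) K"
    unfolding down_def upper_covers_at[OF Suc.prems]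
    by (intro sum.cong refl) (auto intro!: skew_count_Suc[of _ 0] simp: diagrams_0)
  also have "\<dots> = up (down (skew_count {})) K + skew_count {} K"
    by (rule down_up[OF Suc.prems])
  also have "up (down (skew_count {})) K = (\<Sum>J\<in>lower_covers K. Suc n * skew_count {} J)"
    unfolding up_def lower_covers_at[OF Suc.prems] by (intro sum.cong refl Suc.IH) simp
  also have "\<dots> = Suc n * up (skew_count {}) K"
    by (simp only: up_def sum_distrib_left)
  also have "up (skew_count {}) K = skew_count {} K"
    by (rule skew_count_Suc[OF _ Suc.prems, of _ 0, symmetric]) (simp_all add: diagrams_0)
  finally show ?case by (simp add: algebra_simps)
qed

text \<open>
  The Frobenius identity \<open>\<Sum>(f L)\<^sup>2 = n!\<close>: moving one \<open>up\<close> to the other side as \<open>down\<close> produces the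
  factor \<open>n\<close>.
\<close>

lemma sum_skew_count_empty_sq: "(\<Sum>L\<in>diagrams n. (skew_count {} L)\<^sup>2) = fact n"
proof (induction n)
  case 0
  then show ?case by (simp add: diagrams_0 skew_count_def standard_fillings_empty)
next
  case (Suc n)
  have "(\<Sum>L\<in>diagrams (Suc n). (skew_count {} L)\<^sup>2) =
      (\<Sum>L\<in>diagrams (Suc n). up (skew_count {}) L * skew_count {} L)"
    unfolding power2_eq_square
    by (intro sum.cong refl arg_cong2[where f = "(*)"] skew_count_Suc[of _ 0]) (simp_all add: diagrams_0)
  also have "\<dots> = (\<Sum>K\<in>diagrams n. skew_count {} K * down (skew_count {}) K)"
    by (rule up_down_adjoint)
  also have "\<dots> = (\<Sum>K\<in>diagrams n. Suc n * (skew_count {} K)\<^sup>2)"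
    by (intro sum.cong refl) (simp add: down_skew_count_empty power2_eq_square)
  also have "\<dots> = Suc n * fact n" 
    by (simp only: Suc.IH of_nat_mult of_nat_fact flip: sum_distrib_left)
  finally show ?case by (simp add: algebra_simps)
qed

text \<open>
  A standard tableau splits into its entries up to \<open>m\<close>, which fill a straight shape \<open>M\<close>, and the
  others, which fill \<open>L - M\<close>.
\<close>

lemma skew_count_empty_split:
  assumes "m \<le> n" and "L \<in> diagrams n"
  shows "skew_count {} L = (\<Sum>M\<in>diagrams m. skew_count M L * skew_count {} M)"
  using assms
proof (induction n arbitrary: L rule: dec_induct)
  case base
  have "(\<Sum>M\<in>diagrams m. skew_count M L * skew_count {} M) =
      (\<Sum>M\<in>diagrams m. if M = L then skew_count {} L else 0)"
    by (intro sum.cong refl) (use base in \<open>auto simp: skew_count_same_size\<close>)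
  then show ?case using base by (simp add: finite_diagrams)
next
  case (step n)
  have "skew_count {} L = up (skew_count {}) L"
    using step.prems by (intro skew_count_Suc[of _ 0]) (auto simp: diagrams_0)
  also have "\<dots> = (\<Sum>K\<in>lower_covers L. \<Sum>M\<in>diagrams m. skew_count M K * skew_count {} M)"
    unfolding up_def lower_covers_at[OF step.prems] by (intro sum.cong refl step.IH) simp
  also have "\<dots> = (\<Sum>M\<in>diagrams m. up (skew_count M) L * skew_count {} M)"
    by (subst sum.swap) (simp add: up_def sum_distrib_right)
  also have "\<dots> = (\<Sum>M\<in>diagrams m. skew_count M L * skew_count {} M)"
    using step by (intro sum.cong refl) (simp add: skew_count_Suc)
  finally show ?case .
qed

lemma card_diagrams: "card (diagrams n) = card (partitions n)"
  using bij_betw_same_card[OF bij_betw_young_diagram] by simp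

text \<open>
  Cauchy-Schwarz turns the Frobenius identity into a bound on the plain sum, at the price of the
  square root of the number of partitions.
\<close>

lemma sum_skew_count_empty_le:
  "(\<Sum>L\<in>diagrams n. skew_count {} L) \<le> sqrt (fact n) * exp (c1 * sqrt n)"
proof (rule power2_le_imp_le)
  have "(\<Sum>L\<in>diagrams n. skew_count {} L)\<^sup>2 \<le> fact n * real (card (partitions n))"
    using Cauchy_Schwarz_ineq_sum[of "skew_count {}" "\<lambda>_. 1" "diagrams n"]
    by (simp add: sum_skew_count_empty_sq card_diagrams)
  also have "\<dots> \<le> fact n * exp (2 * c1 * sqrt n)"
    by (intro mult_left_mono card_partitions_le) simp
  also have "exp (2 * c1 * sqrt n) = (exp (c1 * sqrt n))\<^sup>2"
    by (simp add: power2_eq_square flip: exp_add)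
  finally show "(\<Sum>L\<in>diagrams n. skew_count {} L)\<^sup>2 \<le> (sqrt (fact n) * exp (c1 * sqrt n))\<^sup>2"
    by (simp add: power_mult_distrib)
qed simp

lemma max_skew_SYT_le:
  assumes "m \<le> n"
  shows "max_skew_SYT m n \<le> sqrt (fact n / fact m)"
proof -
  have "max_skew_SYT m n \<in> (\<lambda>l. Max ((\<lambda>u. num_skew_SYT l u) ` partitions m)) ` partitions n"
    unfolding max_skew_SYT_def using finite_partitions partitions_nonempty by (intro Max_in) auto
  then obtain l where l: "l \<in> partitions n" "max_skew_SYT m n = Max ((\<lambda>u. num_skew_SYT l u) ` partitions m)"
    by blast
  have "max_skew_SYT m n \<in> (\<lambda>u. num_skew_SYT l u) ` partitions m"
    unfolding l(2) using finite_partitions partitions_nonempty by (intro Max_in) auto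
  then obtain u where "u \<in> partitions m" "max_skew_SYT m n = num_skew_SYT l u" by blast
  then show ?thesis
    using skew_count_le_sqrt[of "young_diagram u" m "young_diagram l" n] assms l(1)
    by (simp add: num_skew_SYT_eq young_diagram_mem_diagrams)
qed

lemma skew_count_le_max_skew_SYT:
  assumes "M \<in> diagrams m" "L \<in> diagrams n"
  shows "skew_count M L \<le> max_skew_SYT m n"
proof -
  obtain u where u: "u \<in> partitions m" "M = young_diagram u"
    using assms(1) bij_betw_imp_surj_on[OF bij_betw_young_diagram] by (metis imageE)
  obtain l where l: "l \<in> partitions n" "L = young_diagram l"
    using assms(2) bij_betw_imp_surj_on[OF bij_betw_young_diagram] by (metis imageE)
  have "num_skew_SYT l u \<le> Max ((\<lambda>u. num_skew_SYT l u) ` partitions m)"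
    using u finite_partitions by (intro Max_ge) auto
  also have "\<dots> \<le> max_skew_SYT m n"
    unfolding max_skew_SYT_def using l finite_partitions by (intro Max_ge) auto
  finally show ?thesis by (simp add: u l flip: num_skew_SYT_eq)
qed

text \<open>
  In \<open>n! = \<Sum>(f L)\<^sup>2\<close>, split one factor at level \<open>m\<close> and replace each skew count by the maximum. What
  remains is a product of two plain sums over the levels \<open>n\<close> and \<open>m\<close>.
\<close>

lemma max_skew_SYT_ge:
  assumes "m \<le> n"
  shows "sqrt (fact n / fact m) * exp (- (2 * c1 * sqrt n)) \<le> max_skew_SYT m n"
proof -
  let ?F = "real (max_skew_SYT m n)" and ?f = "skew_count {}"
  have f_nonneg: "?f L \<ge> 0" for L by (simp add: skew_count_def)
  have c1: "c1 \<ge> 0" by (simp add: c1_def)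
  have "fact n = (\<Sum>L\<in>diagrams n. ?f L * (\<Sum>M\<in>diagrams m. skew_count M L * ?f M))"
    unfolding sum_skew_count_empty_sq[symmetric] power2_eq_square
    by (intro sum.cong refl arg_cong2[where f = "(*)"] skew_count_empty_split[OF assms])
  also have "\<dots> \<le> (\<Sum>L\<in>diagrams n. ?f L * (\<Sum>M\<in>diagrams m. ?F * ?f M))"
    by (intro sum_mono mult_left_mono mult_right_mono skew_count_le_max_skew_SYT f_nonneg)
  also have "\<dots> = ?F * ((\<Sum>L\<in>diagrams n. ?f L) * (\<Sum>M\<in>diagrams m. ?f M))"
    by (simp only: sum_distrib_left[symmetric] sum_distrib_right[symmetric] mult_ac)
  also have "\<dots> \<le> ?F * ((sqrt (fact n) * exp (c1 * sqrt n)) * (sqrt (fact m) * exp (c1 * sqrt m)))"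
    by (intro mult_left_mono mult_mono sum_skew_count_empty_le sum_nonneg f_nonneg) auto
  also have "\<dots> \<le> ?F * ((sqrt (fact n) * exp (c1 * sqrt n)) * (sqrt (fact m) * exp (c1 * sqrt n)))"
    using assms c1 by (intro mult_left_mono) (auto intro: mult_left_mono)
  also have "\<dots> = sqrt (fact n) * (?F * sqrt (fact m) * exp (2 * c1 * sqrt n))"
  proof -
    have "exp (2 * c1 * sqrt n) = exp (c1 * sqrt n) * exp (c1 * sqrt n)"
      unfolding exp_add[symmetric] by simp
    then show ?thesis by (simp only: mult_ac)
  qed
  finally have "sqrt (fact n) * sqrt (fact n) \<le> sqrt (fact n) * (?F * sqrt (fact m) * exp (2 * c1 * sqrt n))"
    by simp
  then have "sqrt (fact n) \<le> ?F * sqrt (fact m) * exp (2 * c1 * sqrt n)"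
    by (rule mult_left_le_imp_le) simp
  then show ?thesis
    by (simp add: real_sqrt_divide exp_minus field_simps)
qed

theorem corollary6p2:
  fixes m :: "nat \<Rightarrow> nat"
  assumes "\<forall>\<^sub>F n in sequentially. 1 \<le> m n \<and> m n \<le> n"
  shows "\<exists>\<epsilon> \<delta> :: nat \<Rightarrow> real. \<epsilon> \<longlonglongrightarrow> 0 \<and> \<delta> \<longlonglongrightarrow> 0 \<and>
    (\<forall>\<^sub>F n in sequentially.
      sqrt (fact n / fact (m n)) * exp (- 2 * c1 * sqrt (real n) * (1 + \<epsilon> n))
        \<le> real (max_skew_SYT (m n) n) \<and>
      real (max_skew_SYT (m n) n)
        \<le> sqrt (fact n / fact (m n)) * exp (2 * c1 * sqrt (real n) * (1 + \<delta> n)))"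
proof (intro exI conjI)
  \<comment> \<open>Both bounds hold without an error term.\<close>
  show "(\<lambda>_. 0 :: real) \<longlonglongrightarrow> 0" "(\<lambda>_. 0 :: real) \<longlonglongrightarrow> 0" by simp_all
  show "\<forall>\<^sub>F n in sequentially.
      sqrt (fact n / fact (m n)) * exp (- 2 * c1 * sqrt (real n) * (1 + 0))
        \<le> real (max_skew_SYT (m n) n) \<and>
      real (max_skew_SYT (m n) n)
        \<le> sqrt (fact n / fact (m n)) * exp (2 * c1 * sqrt (real n) * (1 + 0))"
    using assms
  proof eventually_elim
    case (elim n)
    have "max_skew_SYT (m n) n \<le> sqrt (fact n / fact (m n)) * 1"
      using max_skew_SYT_le elim by simp
    also have "\<dots> \<le> sqrt (fact n / fact (m n)) * exp (2 * c1 * sqrt n)"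
      by (intro mult_left_mono) (auto simp: c1_def)
    finally show ?case using max_skew_SYT_ge elim by simp
  qed
qed

end
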